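(* There is a non-constant exponent $p$ on $[0,2]^2$ such that the double average operator $$(Af)(x,y)=\frac1{xy}\int_0^x\int_0^y f(t,\tau)\,dt\,d\tau$$ is bounded in $L^{p(\cdot)}([0,2]^2)$.
   Context: An exponent on $[0,2]^2$ is a measurable function $p$ with $1\le\inf p\le\sup p<\infty$; exponents that agree almost everywhere are identified. $L^{p(\cdot)}([0,2]^2)$ is the space of measurable functions $f$ with $\|f\|_{L^{p(\cdot)}}=\inf\{\lambda>0:\int_{[0,2]^2}|f(x)/\lambda|^{p(x)}dx\le1\}<\infty$. Bounded means that there is $c>0$ with $\|Af\|_{L^{p(\cdot)}}\le c\|f\|_{L^{p(\cdot)}}$ for all $f\in L^{p(\cdot)}([0,2]^2)$. *)

theory Defs
  imports "HOL-Analysis.Analysis"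
begin

definition square :: "(real \<times> real) set" where
  "square = {0..2} \<times> {0..2}"

definition exponent :: "(real \<times> real \<Rightarrow> real) \<Rightarrow> bool" where
  "exponent p \<longleftrightarrow>
     p \<in> borel_measurable (lebesgue_on square) \<and>
     (\<forall>z\<in>square. 1 \<le> p z) \<and> bdd_above (p ` square)"

text \<open>Exponents that agree almost everywhere are identified, so being constant is understood
  almost everywhere.\<close>

definition constant_exponent :: "(real \<times> real \<Rightarrow> real) \<Rightarrow> bool" where
  "constant_exponent p \<longleftrightarrow> (\<exists>c. AE z in lebesgue_on square. p z = c)"

definition modular :: "(real \<times> real \<Rightarrow> real) \<Rightarrow> (real \<times> real \<Rightarrow> real) \<Rightarrow> ennreal" where
  "modular p f = (\<integral>\<^sup>+ z. ennreal (\<bar>f z\<bar> powr p z) \<partial>lebesgue_on square)"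

text \<open>The norm takes values in \<^typ>\<open>ennreal\<close>, so that it is infinite when no
  \<open>\<lambda>\<close> is admissible.\<close>

definition Lp_norm :: "(real \<times> real \<Rightarrow> real) \<Rightarrow> (real \<times> real \<Rightarrow> real) \<Rightarrow> ennreal" where
  "Lp_norm p f = Inf {ennreal l | l. 0 < l \<and> modular p (\<lambda>z. f z / l) \<le> 1}"

definition Lp_space :: "(real \<times> real \<Rightarrow> real) \<Rightarrow> (real \<times> real \<Rightarrow> real) set" where
  "Lp_space p = {f. f \<in> borel_measurable (lebesgue_on square) \<and> Lp_norm p f < \<infinity>}"

text \<open>The first argument of \<open>f\<close> runs over \<open>[0,x]\<close> and the second over \<open>[0,y]\<close>.
  The integrals are taken with respect to \<^const>\<open>lebesgue\<close>, not \<^const>\<open>lborel\<close>: slices of a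
  Lebesgue measurable function need not be Borel measurable.  For \<open>x = 0\<close> or \<open>y = 0\<close> (a null
  set) the value is \<open>0\<close>.\<close>

definition double_average :: "(real \<times> real \<Rightarrow> real) \<Rightarrow> real \<times> real \<Rightarrow> real" where
  "double_average f = (\<lambda>(x, y).
     1 / (x * y) * (LINT t:{0..x}|lebesgue. (LINT \<tau>:{0..y}|lebesgue. f (t, \<tau>))))"

text \<open>The condition that the operator maps the space to itself includes measurability of the
  image, without which its norm would only be formed from a lower integral.\<close>

definition bounded_on_Lp ::
  "(real \<times> real \<Rightarrow> real) \<Rightarrow> ((real \<times> real \<Rightarrow> real) \<Rightarrow> (real \<times> real \<Rightarrow> real)) \<Rightarrow> bool" where
  "bounded_on_Lp p T \<longleftrightarrow>
     (\<forall>f\<in>Lp_space p. T f \<in> Lp_space p) \<and>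
     (\<exists>c::real. 0 < c \<and> (\<forall>f\<in>Lp_space p. Lp_norm p (T f) \<le> ennreal c * Lp_norm p f))"

end

theory Submission
  imports Defs
begin

text \<open>The value of \<open>Af\<close> at \<open>(x, y)\<close> only depends on \<open>f\<close> on the rectangle
  \<open>[0, x] \<times> [0, y]\<close>.  The points of the square outside the corner \<open>(1, 2] \<times> (1, 2]\<close> have
  rectangles that miss the corner, and on the corner the factor \<open>1 / (x y)\<close> is at most
  \<open>1\<close>, so that \<open>Af\<close> is bounded there by the integral of \<open>\<bar>f\<bar>\<close>.  Hence the exponent can be
  changed on the corner at will: take \<open>p = 3\<close> on the corner and \<open>p = 2\<close> on the rest of the
  square.

  Let the modular of \<open>f\<close> be at most \<open>1\<close>.  Off the corner, \<open>Af\<close> agrees with the double average of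
  \<open>f\<close> cut off at the corner, a function whose square has integral at most \<open>1\<close>.  Hardy's
  inequality in \<open>L\<^sup>2\<close> has constant \<open>4\<close> for the square of the norm; used once in each variable
  (\<open>Hardy_nn_average\<close>, \<open>Hardy_nn_double_average\<close>) it gives a bound \<open>16\<close> for the integral of
  \<open>\<bar>Af\<bar>\<^sup>2\<close> off the corner.  On the corner, \<open>\<bar>f\<bar> \<le> 1 + \<bar>f\<bar>\<^sup>p\<close> yields \<open>\<bar>Af\<bar> \<le> 4 + 1\<close>.  Therefore
  the modular of \<open>Af / 10\<close> is at most \<open>16/100 + (1/2)\<^sup>3 \<le> 1\<close> (\<open>modular_double_average_le\<close>), and by
  homogeneity the operator norm is at most \<open>10\<close> (\<open>bounded_on_Lp_of_modular\<close>).

  The estimates use Tonelli's theorem, which concerns Borel functions on the product, whereas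
  \<open>f\<close> is only Lebesgue measurable.  So \<open>f\<close> is replaced by a Borel function \<open>g\<close> that agrees
  with it almost everywhere.  This changes the double average at no point of the square
  (\<open>double_average_eq_lborel\<close>), since almost all slices of \<open>f\<close> and \<open>g\<close> agree almost
  everywhere.\<close>

section \<open>Hardy's inequality in one variable\<close>

lemma nn_integral_powr_from_0:
  fixes x :: real
  assumes "0 \<le> x"
  shows "(\<integral>\<^sup>+ t\<in>{0..x}. ennreal (t powr (-1/2)) \<partial>lborel) = ennreal (2 * x powr (1/2))"
proof -
  have "((\<lambda>t. t powr (-1/2)) has_integral 2 * x powr (1/2)) {0..x}"
    using has_integral_powr_from_0[of "-1/2" x] assms by (simp add: mult.commute)
  then have "((\<lambda>t. t powr (-1/2) * indicator {0..x} t) has_integral 2 * x powr (1/2)) UNIV"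
    unfolding has_integral_restrict_UNIV[of "{0..x}", symmetric]
    by (rule has_integral_eq[rotated]) (auto simp: indicator_def)
  then have "(\<integral>\<^sup>+ t. ennreal (t powr (-1/2) * indicator {0..x} t) \<partial>lborel) = ennreal (2 * x powr (1/2))"
    by (intro nn_integral_has_integral_lborel) auto
  then show ?thesis
    by (simp add: ennreal_mult'' ennreal_indicator)
qed

lemma nn_integral_powr_to_inf:
  fixes t :: real
  assumes "0 < t"
  shows "(\<integral>\<^sup>+ x\<in>{t..}. ennreal (x powr (-3/2)) \<partial>lborel) = ennreal (2 * t powr (-1/2))"
proof -
  have "((\<lambda>x. x powr (-3/2)) has_integral 2 * t powr (-1/2)) {t..}"
    using has_integral_powr_to_inf[of "-3/2" t] assms by (simp add: mult.commute)
  then have "((\<lambda>x. x powr (-3/2) * indicator {t..} x) has_integral 2 * t powr (-1/2)) UNIV"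
    unfolding has_integral_restrict_UNIV[of "{t..}", symmetric]
    by (rule has_integral_eq[rotated]) (auto simp: indicator_def)
  then have "(\<integral>\<^sup>+ x. ennreal (x powr (-3/2) * indicator {t..} x) \<partial>lborel) = ennreal (2 * t powr (-1/2))"
    by (intro nn_integral_has_integral_lborel) auto
  then show ?thesis
    by (simp add: ennreal_mult'' ennreal_indicator)
qed

text \<open>Values in \<^typ>\<open>ennreal\<close> free the inequalities from integrability conditions.  For
  \<open>x \<le> 0\<close> the factor \<open>ennreal (1 / x)\<close> is \<open>0\<close>, so integrals over all \<open>x\<close> are in effect integrals
  over the half-line.\<close>

definition nn_average :: "(real \<Rightarrow> ennreal) \<Rightarrow> real \<Rightarrow> ennreal" where
  "nn_average h x = ennreal (1 / x) * (\<integral>\<^sup>+ t\<in>{0..x}. h t \<partial>lborel)"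

lemma nn_average_measurable [measurable (raw)]:
  assumes [measurable]: "case_prod h \<in> borel_measurable (M \<Otimes>\<^sub>M borel)" "x \<in> borel_measurable M"
  shows "(\<lambda>w. nn_average (h w) (x w)) \<in> borel_measurable M"
proof -
  have [measurable]: "(\<lambda>z. indicator {0..x (fst z)} (snd z) :: ennreal) \<in> borel_measurable (M \<Otimes>\<^sub>M borel)"
    by (simp add: indicator_def)
  have [measurable]: "case_prod (\<lambda>w t. h w t * indicator {0..x w} t) \<in> borel_measurable (M \<Otimes>\<^sub>M borel)"
    unfolding split_beta' by measurable
  have "(\<lambda>w. \<integral>\<^sup>+ t\<in>{0..x w}. h w t \<partial>lborel) \<in> borel_measurable M"
    by (rule lborel.borel_measurable_nn_integral) measurable
  then show ?thesis
    unfolding nn_average_def by measurable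
qed

text \<open>Cauchy-Schwarz with \<open>h = (t\<^sup>1\<^sup>/\<^sup>4 h) t\<^sup>-\<^sup>1\<^sup>/\<^sup>4\<close>.  The weight is singular enough at \<open>0\<close> for the
  remaining kernel \<open>x\<^sup>-\<^sup>3\<^sup>/\<^sup>2 t\<^sup>1\<^sup>/\<^sup>2\<close> to be integrable in \<open>x\<close> over \<open>[t, \<infinity>)\<close>, which a plain
  Cauchy-Schwarz estimate with kernel \<open>x\<^sup>-\<^sup>1\<close> does not achieve, and yet the other factor of the
  estimate, the integral of \<open>t\<^sup>-\<^sup>1\<^sup>/\<^sup>2\<close> over \<open>[0, x]\<close>, is finite.\<close>

lemma nn_average_square_le:
  assumes [measurable]: "h \<in> borel_measurable borel" and "0 < x"
  shows "(nn_average h x)\<^sup>2 \<le>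
    (\<integral>\<^sup>+ t. ennreal (2 * x powr (-3/2)) * (ennreal (t powr (1/2)) * (h t)\<^sup>2 * indicator {0..x} t) \<partial>lborel)"
proof -
  let ?w = "\<lambda>t::real. ennreal (t powr (1/4))" and ?v = "\<lambda>t::real. ennreal (t powr (-1/4))"
  let ?I = "\<lambda>t. indicator {0..x} t :: ennreal"
  have "(\<integral>\<^sup>+ t\<in>{0..x}. h t \<partial>lborel) = (\<integral>\<^sup>+ t. (?w t * h t * ?I t) * (?v t * ?I t) \<partial>lborel)"
  proof (rule nn_integral_cong_AE)
    have "h t * ?I t = (?w t * h t * ?I t) * (?v t * ?I t)" if "t \<noteq> 0" for t
    proof (cases "t \<in> {0..x}")
      case True
      then have "?w t * ?v t = 1"
        using that by (simp add: ennreal_mult[symmetric] powr_add[symmetric])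
      then show ?thesis
        using True by (simp add: ac_simps)
    qed simp
    then show "AE t in lborel. h t * ?I t = (?w t * h t * ?I t) * (?v t * ?I t)"
      using AE_lborel_singleton[of "0::real"] by (auto elim: eventually_mono)
  qed
  then have "(\<integral>\<^sup>+ t\<in>{0..x}. h t \<partial>lborel)\<^sup>2 \<le>
      (\<integral>\<^sup>+ t. (?w t * h t * ?I t)\<^sup>2 \<partial>lborel) * (\<integral>\<^sup>+ t. (?v t * ?I t)\<^sup>2 \<partial>lborel)"
    by (simp only:) (rule Cauchy_Schwarz_nn_integral; measurable)
  also have "(\<integral>\<^sup>+ t. (?v t * ?I t)\<^sup>2 \<partial>lborel) = (\<integral>\<^sup>+ t\<in>{0..x}. ennreal (t powr (-1/2)) \<partial>lborel)"
    by (intro nn_integral_cong)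
       (auto simp: indicator_def ennreal_power power2_eq_square powr_add[symmetric] ennreal_mult[symmetric])
  also have "\<dots> = ennreal (2 * x powr (1/2))"
    using assms by (intro nn_integral_powr_from_0) auto
  also have "(\<integral>\<^sup>+ t. (?w t * h t * ?I t)\<^sup>2 \<partial>lborel) = (\<integral>\<^sup>+ t. ennreal (t powr (1/2)) * (h t)\<^sup>2 * ?I t \<partial>lborel)"
  proof (intro nn_integral_cong)
    fix t :: real
    have "(?w t)\<^sup>2 = ennreal (t powr (1/2))"
      by (simp add: ennreal_power power2_eq_square powr_add[symmetric] ennreal_mult[symmetric])
    then show "(?w t * h t * ?I t)\<^sup>2 = ennreal (t powr (1/2)) * (h t)\<^sup>2 * ?I t"
      by (simp add: indicator_def power_mult_distrib)
  qed
  finally have "(ennreal (1 / x))\<^sup>2 * (\<integral>\<^sup>+ t\<in>{0..x}. h t \<partial>lborel)\<^sup>2 \<le>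
      (ennreal (1 / x))\<^sup>2 * ((\<integral>\<^sup>+ t. ennreal (t powr (1/2)) * (h t)\<^sup>2 * ?I t \<partial>lborel) * ennreal (2 * x powr (1/2)))"
    by (rule mult_left_mono) simp
  also have "\<dots> = ((ennreal (1 / x))\<^sup>2 * ennreal (2 * x powr (1/2))) *
      (\<integral>\<^sup>+ t. ennreal (t powr (1/2)) * (h t)\<^sup>2 * ?I t \<partial>lborel)"
    by (simp add: ac_simps)
  also have "(ennreal (1 / x))\<^sup>2 * ennreal (2 * x powr (1/2)) = ennreal (2 * x powr (-3/2))"
  proof -
    have "x powr (-3/2) = x powr (-2) * x powr (1/2)"
      by (simp add: powr_add[symmetric])
    also have "x powr (-2) = (1 / x)\<^sup>2"
      using \<open>0 < x\<close> by (simp add: powr_minus field_simps)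
    finally show ?thesis
      using \<open>0 < x\<close> by (simp add: ennreal_power ennreal_mult[symmetric])
  qed
  finally show ?thesis
    unfolding nn_average_def by (simp add: power_mult_distrib nn_integral_cmult)
qed

text \<open>After the weighted Cauchy-Schwarz estimate, Tonelli's theorem leaves the kernel
  \<open>2 x\<^sup>-\<^sup>3\<^sup>/\<^sup>2 t\<^sup>1\<^sup>/\<^sup>2\<close>, whose integral over \<open>x \<ge> t\<close> is \<open>4\<close> for every \<open>t > 0\<close>.\<close>

lemma Hardy_nn_average:
  assumes [measurable]: "h \<in> borel_measurable borel"
  shows "(\<integral>\<^sup>+ x. (nn_average h x)\<^sup>2 \<partial>lborel) \<le> 4 * (\<integral>\<^sup>+ t. (h t)\<^sup>2 \<partial>lborel)"
proof -
  let ?k = "\<lambda>x t. ennreal (2 * x powr (-3/2)) * (ennreal (t powr (1/2)) * (h t)\<^sup>2 * indicator {0..x} t)"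
  have [measurable]: "(\<lambda>z. indicator {0..fst z} (snd z) :: ennreal) \<in> borel_measurable (borel \<Otimes>\<^sub>M (borel :: real measure))"
    by (simp add: indicator_def)
  have "(nn_average h x)\<^sup>2 \<le> (\<integral>\<^sup>+ t. ?k x t \<partial>lborel)" for x
  proof (cases "0 < x")
    case False
    then have "ennreal (1 / x) = 0"
      by (simp add: ennreal_neg)
    then show ?thesis
      by (simp add: nn_average_def)
  qed (use nn_average_square_le in auto)
  then have "(\<integral>\<^sup>+ x. (nn_average h x)\<^sup>2 \<partial>lborel) \<le> (\<integral>\<^sup>+ x. (\<integral>\<^sup>+ t. ?k x t \<partial>lborel) \<partial>lborel)"
    by (intro nn_integral_mono) auto
  also have "\<dots> = (\<integral>\<^sup>+ t. (\<integral>\<^sup>+ x. ?k x t \<partial>lborel) \<partial>lborel)"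
    by (rule lborel_pair.Fubini'[symmetric]) (simp add: split_beta')
  also have "\<dots> \<le> (\<integral>\<^sup>+ t. 4 * (h t)\<^sup>2 \<partial>lborel)"
  proof (rule nn_integral_mono)
    fix t :: real
    show "(\<integral>\<^sup>+ x. ?k x t \<partial>lborel) \<le> 4 * (h t)\<^sup>2"
    proof (cases "0 < t")
      case False
      then have "?k x t = 0" for x
        by (cases "t = 0") (auto simp: indicator_def)
      then show ?thesis
        by (simp only: nn_integral_const mult_zero_left zero_le)
    next
      case True
      have "(\<integral>\<^sup>+ x. ?k x t \<partial>lborel) =
          (\<integral>\<^sup>+ x. (2 * ennreal (t powr (1/2)) * (h t)\<^sup>2) * (ennreal (x powr (-3/2)) * indicator {t..} x) \<partial>lborel)"
        using True by (intro nn_integral_cong) (auto simp: indicator_def ennreal_mult ac_simps)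
      also have "\<dots> = (2 * ennreal (t powr (1/2)) * (h t)\<^sup>2) * ennreal (2 * t powr (-1/2))"
        by (simp only: nn_integral_cmult nn_integral_powr_to_inf[OF True, symmetric]) (rule nn_integral_cmult, measurable)
      also have "\<dots> = (ennreal 2 * ennreal (t powr (1/2)) * ennreal (2 * t powr (-1/2))) * (h t)\<^sup>2"
        by (simp add: ac_simps)
      also have "ennreal 2 * ennreal (t powr (1/2)) * ennreal (2 * t powr (-1/2)) =
          ennreal (4 * (t powr (1/2) * t powr (-1/2)))"
        by (simp only: ennreal_mult[symmetric] mult_nonneg_nonneg powr_ge_zero zero_le_numeral)
           (simp add: ac_simps)
      also have "t powr (1/2) * t powr (-1/2) = 1"
        using True by (simp add: powr_add[symmetric])
      finally show ?thesis by simp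
    qed
  qed
  finally show ?thesis by (simp add: nn_integral_cmult)
qed

section \<open>Hardy's inequality in two variables\<close>

definition nn_double_average :: "(real \<times> real \<Rightarrow> ennreal) \<Rightarrow> real \<times> real \<Rightarrow> ennreal" where
  "nn_double_average g = (\<lambda>(x, y). nn_average (\<lambda>t. nn_average (\<lambda>\<tau>. g (t, \<tau>)) y) x)"

lemma nn_double_average_measurable:
  assumes [measurable]: "g \<in> borel_measurable borel"
  shows "nn_double_average g \<in> borel_measurable borel"
  unfolding nn_double_average_def split_beta' by (simp add: borel_prod[symmetric])

text \<open>The double average is the average in \<open>x\<close> of the average in \<open>y\<close>, so the inequality in one
  variable applies first in \<open>x\<close> for fixed \<open>y\<close> and then in \<open>y\<close> for fixed \<open>t\<close>.\<close>

lemma Hardy_nn_double_average: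
  assumes "g \<in> borel_measurable borel"
  shows "(\<integral>\<^sup>+ z. (nn_double_average g z)\<^sup>2 \<partial>lborel) \<le> 16 * (\<integral>\<^sup>+ z. (g z)\<^sup>2 \<partial>lborel)"
proof -
  have g[measurable]: "g \<in> borel_measurable (borel \<Otimes>\<^sub>M borel)"
    using assms by (simp add: borel_prod)
  let ?G = "\<lambda>t y. nn_average (\<lambda>\<tau>. g (t, \<tau>)) y"
  have "(\<integral>\<^sup>+ z. (nn_double_average g z)\<^sup>2 \<partial>lborel) =
      (\<integral>\<^sup>+ y. (\<integral>\<^sup>+ x. (nn_average (\<lambda>t. ?G t y) x)\<^sup>2 \<partial>lborel) \<partial>lborel)"
    unfolding lborel_prod[symmetric] nn_double_average_def
    by (subst lborel_pair.nn_integral_snd[symmetric]) auto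
  also have "\<dots> \<le> (\<integral>\<^sup>+ y. 4 * (\<integral>\<^sup>+ t. (?G t y)\<^sup>2 \<partial>lborel) \<partial>lborel)"
    by (intro nn_integral_mono Hardy_nn_average) measurable
  also have "\<dots> = 4 * (\<integral>\<^sup>+ y. (\<integral>\<^sup>+ t. (?G t y)\<^sup>2 \<partial>lborel) \<partial>lborel)"
    by (rule nn_integral_cmult) measurable
  also have "(\<integral>\<^sup>+ y. (\<integral>\<^sup>+ t. (?G t y)\<^sup>2 \<partial>lborel) \<partial>lborel) =
      (\<integral>\<^sup>+ t. (\<integral>\<^sup>+ y. (?G t y)\<^sup>2 \<partial>lborel) \<partial>lborel)"
    by (rule lborel_pair.Fubini') measurable
  also have "\<dots> \<le> (\<integral>\<^sup>+ t. 4 * (\<integral>\<^sup>+ \<tau>. (g (t, \<tau>))\<^sup>2 \<partial>lborel) \<partial>lborel)"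
    by (intro nn_integral_mono Hardy_nn_average) measurable
  also have "\<dots> = 4 * (\<integral>\<^sup>+ t. (\<integral>\<^sup>+ \<tau>. (g (t, \<tau>))\<^sup>2 \<partial>lborel) \<partial>lborel)"
    by (rule nn_integral_cmult) measurable
  also have "(\<integral>\<^sup>+ t. (\<integral>\<^sup>+ \<tau>. (g (t, \<tau>))\<^sup>2 \<partial>lborel) \<partial>lborel) = (\<integral>\<^sup>+ z. (g z)\<^sup>2 \<partial>lborel)"
    unfolding lborel_prod[symmetric] by (rule lborel.nn_integral_fst) measurable
  finally show ?thesis
    by (simp add: mult.assoc[symmetric] mult_left_mono)
qed

text \<open>Monotonicity is stated with a hypothesis on the rectangle only: it then also allows one to
  cut off \<open>g\<close> outside the rectangle.\<close>

lemma nn_double_average_mono: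
  assumes "\<And>t \<tau>. \<lbrakk>t \<in> {0..x}; \<tau> \<in> {0..y}\<rbrakk> \<Longrightarrow> g (t, \<tau>) \<le> g' (t, \<tau>)"
  shows "nn_double_average g (x, y) \<le> nn_double_average g' (x, y)"
proof -
  have mono: "nn_average h r \<le> nn_average h' r" if "\<And>t. t \<in> {0..r} \<Longrightarrow> h t \<le> h' t" for h h' r
    unfolding nn_average_def using that
    by (intro mult_left_mono nn_integral_mono) (auto simp: indicator_def)
  show ?thesis
    using assms by (auto simp: nn_double_average_def intro!: mono)
qed

lemma nn_double_average_le_nn_integral:
  assumes "g \<in> borel_measurable borel" "1 \<le> x" "1 \<le> y"
  shows "nn_double_average g (x, y) \<le> (\<integral>\<^sup>+ z. g z \<partial>lborel)"
proof -
  have g[measurable]: "g \<in> borel_measurable (borel \<Otimes>\<^sub>M borel)"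
    using assms by (simp add: borel_prod)
  have le: "nn_average h r \<le> (\<integral>\<^sup>+ t. h t \<partial>lborel)" if "1 \<le> r" for h r
  proof -
    have "nn_average h r \<le> 1 * (\<integral>\<^sup>+ t. h t \<partial>lborel)"
      unfolding nn_average_def using that
      by (intro mult_mono nn_integral_mono) (auto simp: indicator_def)
    then show ?thesis by simp
  qed
  have "nn_double_average g (x, y) \<le> (\<integral>\<^sup>+ t. nn_average (\<lambda>\<tau>. g (t, \<tau>)) y \<partial>lborel)"
    using le assms by (simp add: nn_double_average_def)
  also have "\<dots> \<le> (\<integral>\<^sup>+ t. (\<integral>\<^sup>+ \<tau>. g (t, \<tau>) \<partial>lborel) \<partial>lborel)"
    using le assms by (intro nn_integral_mono) auto
  also have "\<dots> = (\<integral>\<^sup>+ z. g z \<partial>lborel)"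
    unfolding lborel_prod[symmetric] by (rule lborel.nn_integral_fst) measurable
  finally show ?thesis .
qed

section \<open>The double average of a Lebesgue measurable function\<close>

text \<open>For a non-integrable function the integral on the left is \<open>0\<close>.\<close>

lemma ennreal_abs_integral_le:
  fixes f :: "'a \<Rightarrow> real"
  shows "ennreal \<bar>LINT x|M. f x\<bar> \<le> (\<integral>\<^sup>+ x. ennreal \<bar>f x\<bar> \<partial>M)"
  using integral_norm_bound_ennreal[of M f]
  by (cases "integrable M f") (auto simp: not_integrable_integral_eq)

lemma integral_lebesgue_eq_lborel_AE:
  fixes f g :: "'a::euclidean_space \<Rightarrow> real"
  assumes g: "g \<in> borel_measurable borel" and eq: "AE x in lborel. f x = g x"
  shows "(LINT x|lebesgue. f x) = (LINT x|lborel. g x)"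
proof -
  have g': "g \<in> borel_measurable lebesgue"
    using g by (simp add: measurable_completion)
  have eq': "AE x in lebesgue. g x = f x"
    using eq by (simp add: AE_completion_iff eq_commute)
  have "f \<in> borel_measurable lebesgue"
    by (rule borel_measurable_AE[OF g' eq'])
  then have "(LINT x|lebesgue. f x) = (LINT x|lebesgue. g x)"
    using g' eq' by (intro integral_cong_AE) (auto simp: eq_commute)
  also have "\<dots> = (LINT x|lborel. g x)"
    using g by (intro integral_completion) simp
  finally show ?thesis .
qed

definition lborel_double_average :: "(real \<times> real \<Rightarrow> real) \<Rightarrow> real \<times> real \<Rightarrow> real" where
  "lborel_double_average g = (\<lambda>(x, y).
     1 / (x * y) * (LINT t:{0..x}|lborel. (LINT \<tau>:{0..y}|lborel. g (t, \<tau>))))"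

lemma lborel_double_average_measurable:
  assumes "g \<in> borel_measurable borel"
  shows "lborel_double_average g \<in> borel_measurable borel"
proof -
  have g[measurable]: "g \<in> borel_measurable (borel \<Otimes>\<^sub>M borel)"
    using assms by (simp add: borel_prod)
  have [measurable]: "(\<lambda>w. indicator {0..a w} (b w) :: real) \<in> borel_measurable M"
    if [measurable]: "a \<in> borel_measurable M" "b \<in> borel_measurable M"
    for a b :: "_ \<Rightarrow> real" and M
    by (simp add: indicator_def)
  have "lborel_double_average g \<in> borel_measurable (borel \<Otimes>\<^sub>M borel)"
    unfolding lborel_double_average_def split_beta' set_lebesgue_integral_def by measurable
  then show ?thesis
    by (simp add: borel_prod)
qed

text \<open>For almost every \<open>t\<close> the slices of \<open>f\<close> and \<open>g\<close> at \<open>t\<close> agree almost everywhere.  The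
  exceptional set of \<open>t\<close> does not depend on \<open>(x, y)\<close> and has no influence on the outer integral,
  so the averages agree at every point and not just almost everywhere.\<close>

lemma double_average_eq_lborel:
  assumes g: "g \<in> borel_measurable borel"
    and eq: "AE z in lborel. z \<in> square \<longrightarrow> f z = g z"
    and z: "z \<in> square"
  shows "double_average f z = lborel_double_average g z"
proof -
  obtain x y where xy: "z = (x, y)" "0 \<le> x" "x \<le> 2" "0 \<le> y" "y \<le> 2"
    using z by (auto simp: square_def)
  have g'[measurable]: "g \<in> borel_measurable (borel \<Otimes>\<^sub>M borel)"
    using g by (simp add: borel_prod)
  have "AE t in lborel. AE \<tau> in lborel. (t, \<tau>) \<in> square \<longrightarrow> f (t, \<tau>) = g (t, \<tau>)"
    by (rule lborel_pair.AE_pair[OF eq[folded lborel_prod]])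
  then have "AE t in lborel. indicator {0..x} t *\<^sub>R (LINT \<tau>:{0..y}|lebesgue. f (t, \<tau>)) =
      indicator {0..x} t *\<^sub>R (LINT \<tau>:{0..y}|lborel. g (t, \<tau>))"
  proof (rule eventually_mono)
    fix t assume t: "AE \<tau> in lborel. (t, \<tau>) \<in> square \<longrightarrow> f (t, \<tau>) = g (t, \<tau>)"
    have "(LINT \<tau>:{0..y}|lebesgue. f (t, \<tau>)) = (LINT \<tau>:{0..y}|lborel. g (t, \<tau>))" if "t \<in> {0..x}"
      unfolding set_lebesgue_integral_def
    proof (rule integral_lebesgue_eq_lborel_AE)
      show "AE \<tau> in lborel. indicator {0..y} \<tau> *\<^sub>R f (t, \<tau>) = indicator {0..y} \<tau> *\<^sub>R g (t, \<tau>)"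
        using t by (rule eventually_mono) (use that xy in \<open>auto simp: square_def indicator_def\<close>)
    qed measurable
    then show "indicator {0..x} t *\<^sub>R (LINT \<tau>:{0..y}|lebesgue. f (t, \<tau>)) =
        indicator {0..x} t *\<^sub>R (LINT \<tau>:{0..y}|lborel. g (t, \<tau>))"
      by (auto simp: indicator_def)
  qed
  moreover have "(\<lambda>t. indicator {0..x} t *\<^sub>R (LINT \<tau>:{0..y}|lborel. g (t, \<tau>))) \<in> borel_measurable borel"
    unfolding set_lebesgue_integral_def by measurable
  ultimately show ?thesis
    unfolding xy double_average_def lborel_double_average_def
    by (simp add: set_lebesgue_integral_def[of _ "{0..x}"] integral_lebesgue_eq_lborel_AE)
qed

lemma abs_lborel_double_average_le:
  assumes "0 \<le> x" "0 \<le> y"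
  shows "ennreal \<bar>lborel_double_average g (x, y)\<bar> \<le> nn_double_average (\<lambda>z. ennreal \<bar>g z\<bar>) (x, y)"
proof -
  have set: "ennreal \<bar>LINT t:{0..r}|lborel. h t\<bar> \<le> (\<integral>\<^sup>+ t\<in>{0..r}. ennreal \<bar>h t\<bar> \<partial>lborel)"
    for h :: "real \<Rightarrow> real" and r
  proof -
    have "ennreal \<bar>LINT t:{0..r}|lborel. h t\<bar> \<le> (\<integral>\<^sup>+ t. ennreal \<bar>indicator {0..r} t *\<^sub>R h t\<bar> \<partial>lborel)"
      unfolding set_lebesgue_integral_def by (rule ennreal_abs_integral_le)
    also have "\<dots> = (\<integral>\<^sup>+ t\<in>{0..r}. ennreal \<bar>h t\<bar> \<partial>lborel)"
      by (intro nn_integral_cong) (simp add: indicator_def)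
    finally show ?thesis .
  qed
  have avg: "ennreal \<bar>1 / r * (LINT t:{0..r}|lborel. h t)\<bar> \<le> nn_average H r"
    if "0 \<le> r" and "\<And>t. ennreal \<bar>h t\<bar> \<le> H t" for h :: "real \<Rightarrow> real" and H r
  proof -
    have "ennreal \<bar>1 / r * (LINT t:{0..r}|lborel. h t)\<bar> = ennreal (1 / r) * ennreal \<bar>LINT t:{0..r}|lborel. h t\<bar>"
      using that by (simp add: abs_mult ennreal_mult[symmetric])
    also have "\<dots> \<le> ennreal (1 / r) * (\<integral>\<^sup>+ t\<in>{0..r}. H t \<partial>lborel)"
      using that by (intro mult_left_mono order_trans[OF set] nn_integral_mono mult_right_mono) auto
    finally show ?thesis
      by (simp add: nn_average_def)
  qed
  have "lborel_double_average g (x, y) =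
      1 / x * (LINT t:{0..x}|lborel. 1 / y * (LINT \<tau>:{0..y}|lborel. g (t, \<tau>)))"
    by (simp add: lborel_double_average_def)
  also have "ennreal \<bar>\<dots>\<bar> \<le> nn_double_average (\<lambda>z. ennreal \<bar>g z\<bar>) (x, y)"
    unfolding nn_double_average_def prod.case
    by (intro avg assms order_refl)
  finally show ?thesis .
qed

section \<open>From modulars to norms\<close>

text \<open>If \<open>l\<close> is admissible in the norm of \<open>f\<close>, then the hypothesis on \<open>f / l\<close> says that \<open>c l\<close> is
  admissible in the norm of \<open>T f\<close>.\<close>

lemma bounded_on_Lp_of_modular:
  assumes c: "0 < c"
    and homogeneous: "\<And>f l. 0 < l \<Longrightarrow> T (\<lambda>z. f z / l) = (\<lambda>z. T f z / l)"
    and measurable: "\<And>f. f \<in> borel_measurable (lebesgue_on square) \<Longrightarrow>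
      T f \<in> borel_measurable (lebesgue_on square)"
    and modular: "\<And>f. \<lbrakk>f \<in> borel_measurable (lebesgue_on square); modular p f \<le> 1\<rbrakk> \<Longrightarrow>
      modular p (\<lambda>z. T f z / c) \<le> 1"
  shows "bounded_on_Lp p T"
proof -
  have bound: "Lp_norm p (T f) \<le> ennreal c * Lp_norm p f"
    if f: "f \<in> borel_measurable (lebesgue_on square)" for f
  proof -
    \<comment> \<open>Dividing by \<open>c\<close> puts the bound into the form of a lower bound for the admissible \<open>l\<close>.\<close>
    have "Lp_norm p (T f) / ennreal c \<le> ennreal l" if l: "0 < l" "modular p (\<lambda>z. f z / l) \<le> 1" for l
    proof -
      have "modular p (\<lambda>z. T (\<lambda>z. f z / l) z / c) \<le> 1"
        using f l by (intro modular) auto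
      then have "modular p (\<lambda>z. T f z / (c * l)) \<le> 1"
        by (simp add: homogeneous l mult.commute)
      then have "Lp_norm p (T f) \<le> ennreal (c * l)"
        unfolding Lp_norm_def using c l by (intro Inf_lower) auto
      also have "\<dots> = ennreal c * ennreal l"
        using c l by (simp add: ennreal_mult)
      finally show ?thesis
        using c by (intro divide_le_posI_ennreal) (auto simp: mult.commute)
    qed
    then have "Lp_norm p (T f) / ennreal c \<le> Lp_norm p f"
      unfolding Lp_norm_def[of p f] by (intro Inf_greatest) auto
    then have "ennreal c * (Lp_norm p (T f) / ennreal c) \<le> ennreal c * Lp_norm p f"
      by (rule mult_left_mono) simp
    also have "ennreal c * (Lp_norm p (T f) / ennreal c) = Lp_norm p (T f)"
      using c by (simp add: ennreal_times_divide ennreal_mult_divide_eq mult.commute[of "ennreal c"])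
    finally show ?thesis .
  qed
  have "T f \<in> Lp_space p" if "f \<in> Lp_space p" for f
  proof -
    have "Lp_norm p (T f) \<le> ennreal c * Lp_norm p f"
      using that by (intro bound) (simp add: Lp_space_def)
    also have "\<dots> < \<infinity>"
      using that by (simp add: Lp_space_def ennreal_mult_less_top)
    finally show ?thesis
      using that measurable by (simp add: Lp_space_def)
  qed
  then show ?thesis
    unfolding bounded_on_Lp_def using c bound by (auto simp: Lp_space_def)
qed

section \<open>The exponent\<close>

definition corner :: "(real \<times> real) set" where
  "corner = {1<..2} \<times> {1<..2}"

definition corner_exponent :: "real \<times> real \<Rightarrow> real" where
  "corner_exponent z = (if z \<in> corner then 3 else 2)"

lemma corner_subset_square: "corner \<subseteq> square"
  by (auto simp: corner_def square_def)

lemma square_borel [measurable]: "square \<in> sets borel"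
  and corner_borel [measurable]: "corner \<in> sets borel"
  unfolding square_def corner_def by (simp_all add: borel_prod[symmetric])

lemma emeasure_square: "emeasure lborel square = 4"
  and emeasure_corner: "emeasure lborel corner = 1"
  unfolding square_def corner_def lborel_prod[symmetric]
  by (simp_all add: lborel.emeasure_pair_measure_Times ennreal_mult[symmetric] flip: ennreal_numeral)

lemma corner_exponent_measurable [measurable]: "corner_exponent \<in> borel_measurable borel"
  unfolding corner_exponent_def by measurable

lemma exponent_corner_exponent: "exponent corner_exponent"
proof -
  have "corner_exponent \<in> borel_measurable (lebesgue_on square)"
    by (intro measurable_restrict_space1 measurable_completion) simp
  then show ?thesis
    unfolding exponent_def by (auto simp: corner_exponent_def intro!: bdd_aboveI[of _ 3])
qed

lemma not_constant_corner_exponent: "\<not> constant_exponent corner_exponent"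
proof
  assume "constant_exponent corner_exponent"
  then obtain c where "AE z in lebesgue_on square. corner_exponent z = c"
    by (auto simp: constant_exponent_def)
  then have c: "AE z in lborel. z \<in> square \<longrightarrow> corner_exponent z = c"
    by (simp add: AE_restrict_space_iff AE_completion_iff)
  have *: "emeasure lborel S = 0"
    if S: "S \<subseteq> square" "S \<in> sets borel" "\<And>z. z \<in> S \<Longrightarrow> corner_exponent z \<noteq> c" for S
  proof -
    have "AE z in lborel. z \<notin> S"
      using c by (rule eventually_mono) (use S in auto)
    then show ?thesis
      using S by (subst (asm) AE_iff_measurable[of S]) auto
  qed
  show False
  proof (cases "c = 3")
    case True
    have "emeasure lborel (square - corner) = 4 - 1"
      using corner_subset_square
      by (subst emeasure_Diff) (auto simp: emeasure_square emeasure_corner)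
    moreover have "emeasure lborel (square - corner) = 0"
      using True by (intro *) (auto simp: corner_exponent_def)
    moreover have "(4 - 1 :: ennreal) = 3"
      using ennreal_minus[of 1 4] by simp
    ultimately show False by simp
  next
    case False
    have "emeasure lborel corner = 0"
      using False corner_subset_square by (intro *) (auto simp: corner_exponent_def)
    then show False
      by (simp add: emeasure_corner)
  qed
qed

section \<open>Boundedness of the double average\<close>

lemma modular_eq_lborel:
  assumes "AE z in lborel. z \<in> square \<longrightarrow> f z = g z"
  shows "modular p f = (\<integral>\<^sup>+ z\<in>square. ennreal (\<bar>g z\<bar> powr p z) \<partial>lborel)"
proof -
  have "modular p f = (\<integral>\<^sup>+ z\<in>square. ennreal (\<bar>f z\<bar> powr p z) \<partial>lborel)"
    by (simp add: modular_def nn_integral_restrict_space nn_integral_completion)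
  also have "\<dots> = (\<integral>\<^sup>+ z\<in>square. ennreal (\<bar>g z\<bar> powr p z) \<partial>lborel)"
    using assms by (intro nn_integral_cong_AE) (auto elim!: eventually_mono simp: indicator_def)
  finally show ?thesis .
qed

text \<open>Pointwise \<open>\<bar>g\<bar> \<le> 1 + \<bar>g\<bar>\<^sup>p\<close>, and the square has area \<open>4\<close>.\<close>

lemma nn_integral_abs_le_modular:
  fixes g p :: "real \<times> real \<Rightarrow> real"
  assumes [measurable]: "g \<in> borel_measurable borel" "p \<in> borel_measurable borel"
    and p: "\<And>z. z \<in> square \<Longrightarrow> 1 \<le> p z"
  shows "(\<integral>\<^sup>+ z\<in>square. ennreal \<bar>g z\<bar> \<partial>lborel) \<le>
    4 + (\<integral>\<^sup>+ z\<in>square. ennreal (\<bar>g z\<bar> powr p z) \<partial>lborel)"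
proof -
  have "\<bar>g z\<bar> \<le> 1 + \<bar>g z\<bar> powr p z" if "z \<in> square" for z
  proof (cases "\<bar>g z\<bar> \<le> 1")
    case False
    then show ?thesis
      using powr_mono[of 1 "p z" "\<bar>g z\<bar>"] p[OF that] by simp
  qed (simp add: add_increasing2)
  then have "ennreal \<bar>g z\<bar> \<le> 1 + ennreal (\<bar>g z\<bar> powr p z)" if "z \<in> square" for z
    using that by (simp flip: ennreal_1 ennreal_plus)
  then have "(\<integral>\<^sup>+ z\<in>square. ennreal \<bar>g z\<bar> \<partial>lborel) \<le>
      (\<integral>\<^sup>+ z. indicator square z + ennreal (\<bar>g z\<bar> powr p z) * indicator square z \<partial>lborel)"
    by (intro nn_integral_mono) (auto simp: indicator_def)
  also have "\<dots> = 4 + (\<integral>\<^sup>+ z\<in>square. ennreal (\<bar>g z\<bar> powr p z) \<partial>lborel)"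
    by (subst nn_integral_add) (auto simp: emeasure_square)
  finally show ?thesis .
qed

text \<open>The factor \<open>1/10\<close> leaves room for both parts of the square: the part off the corner
  contributes at most \<open>16/100\<close> by Hardy's inequality, the corner at most \<open>1/8\<close>, because it has
  area \<open>1\<close> and \<open>\<bar>Ag / 10\<bar> \<le> 1/2\<close> there.\<close>

lemma modular_double_average_le:
  assumes g[measurable]: "g \<in> borel_measurable borel"
    and modular: "(\<integral>\<^sup>+ z\<in>square. ennreal (\<bar>g z\<bar> powr corner_exponent z) \<partial>lborel) \<le> 1"
  shows "(\<integral>\<^sup>+ z\<in>square. ennreal (\<bar>lborel_double_average g z / 10\<bar> powr corner_exponent z) \<partial>lborel) \<le> 1"
proof -
  let ?A = "lborel_double_average g"
  \<comment> \<open>Where the exponent is \<open>2\<close> the modular is the integral of the square of \<open>g\<close>; so the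
    integral of the square of \<open>h\<close> is at most the modular of \<open>g\<close>.\<close>
  define h where "h z = ennreal \<bar>g z\<bar> * indicator (square - corner) z" for z
  have h[measurable]: "h \<in> borel_measurable borel"
    unfolding h_def by measurable
  have [measurable]: "nn_double_average h \<in> borel_measurable borel"
    by (rule nn_double_average_measurable) measurable
  have on_corner: "ennreal (\<bar>?A z / 10\<bar> powr corner_exponent z) \<le> ennreal (1 / 8)" if z: "z \<in> corner" for z
  proof -
    obtain x y where xy: "z = (x, y)" "1 < x" "x \<le> 2" "1 < y" "y \<le> 2"
      using z by (auto simp: corner_def)
    have "ennreal \<bar>?A z\<bar> \<le> nn_double_average (\<lambda>z. ennreal \<bar>g z\<bar>) z"
      unfolding xy using xy by (intro abs_lborel_double_average_le) auto
    also have "\<dots> \<le> nn_double_average (\<lambda>z. ennreal \<bar>g z\<bar> * indicator square z) z"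
      unfolding xy using xy by (intro nn_double_average_mono) (auto simp: square_def)
    also have "\<dots> \<le> (\<integral>\<^sup>+ z\<in>square. ennreal \<bar>g z\<bar> \<partial>lborel)"
      unfolding xy using xy by (intro nn_double_average_le_nn_integral) auto
    also have "\<dots> \<le> 4 + (\<integral>\<^sup>+ z\<in>square. ennreal (\<bar>g z\<bar> powr corner_exponent z) \<partial>lborel)"
      by (rule nn_integral_abs_le_modular) (auto simp: corner_exponent_def)
    also have "\<dots> \<le> 4 + 1"
      by (intro add_left_mono modular)
    also have "(4 + 1 :: ennreal) = ennreal 5"
      by simp
    finally have "\<bar>?A z\<bar> \<le> 5"
      by (subst (asm) ennreal_le_iff) auto
    then have "\<bar>?A z / 10\<bar> powr 3 \<le> (1 / 2) powr 3"
      by (intro powr_mono2) auto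
    then show ?thesis
      using z by (simp add: corner_exponent_def power_divide)
  qed
  have off_corner: "ennreal (\<bar>?A z / 10\<bar> powr corner_exponent z) \<le> ennreal (1 / 100) * (nn_double_average h z)\<^sup>2"
    if z: "z \<in> square - corner" for z
  proof -
    obtain x y where xy: "z = (x, y)" "0 \<le> x" "x \<le> 2" "0 \<le> y" "y \<le> 2"
      using z by (auto simp: square_def)
    have "ennreal \<bar>?A z\<bar> \<le> nn_double_average (\<lambda>z. ennreal \<bar>g z\<bar>) z"
      unfolding xy using xy by (intro abs_lborel_double_average_le) auto
    also have "\<dots> \<le> nn_double_average h z"
      \<comment> \<open>Here \<open>x \<le> 1\<close> or \<open>y \<le> 1\<close>, so the rectangle of \<open>(x, y)\<close> misses the corner.\<close>
      unfolding xy using xy z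
      by (intro nn_double_average_mono) (auto simp: square_def corner_def h_def)
    finally have "ennreal (1 / 100) * (ennreal \<bar>?A z\<bar>)\<^sup>2 \<le> ennreal (1 / 100) * (nn_double_average h z)\<^sup>2"
      by (intro mult_left_mono power_mono) auto
    moreover have "\<bar>?A z / 10\<bar> powr corner_exponent z = 1 / 100 * \<bar>?A z\<bar>\<^sup>2"
      using z by (simp add: corner_exponent_def power_divide)
    ultimately show ?thesis
      by (simp only: ennreal_mult ennreal_power zero_le_power2 abs_ge_zero)
  qed
  have "(\<integral>\<^sup>+ z\<in>square. ennreal (\<bar>?A z / 10\<bar> powr corner_exponent z) \<partial>lborel) \<le>
      (\<integral>\<^sup>+ z. ennreal (1 / 100) * (nn_double_average h z)\<^sup>2 + ennreal (1 / 8) * indicator corner z \<partial>lborel)"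
    using on_corner off_corner
    by (intro nn_integral_mono) (auto simp: indicator_def intro: add_increasing)
  also have "\<dots> = ennreal (1 / 100) * (\<integral>\<^sup>+ z. (nn_double_average h z)\<^sup>2 \<partial>lborel) + ennreal (1 / 8)"
    by (subst nn_integral_add) (auto simp: nn_integral_cmult emeasure_corner)
  also have "(\<integral>\<^sup>+ z. (nn_double_average h z)\<^sup>2 \<partial>lborel) \<le> 16 * (\<integral>\<^sup>+ z. (h z)\<^sup>2 \<partial>lborel)"
    by (rule Hardy_nn_double_average) measurable
  also have "(\<integral>\<^sup>+ z. (h z)\<^sup>2 \<partial>lborel) \<le> 1"
  proof -
    have "(h z)\<^sup>2 \<le> ennreal (\<bar>g z\<bar> powr corner_exponent z) * indicator square z" for z
      by (auto simp: h_def indicator_def corner_exponent_def ennreal_power)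
    then show ?thesis
      by (intro order_trans[OF nn_integral_mono modular]) auto
  qed
  finally have "(\<integral>\<^sup>+ z\<in>square. ennreal (\<bar>?A z / 10\<bar> powr corner_exponent z) \<partial>lborel) \<le>
      ennreal (1 / 100) * (16 * 1) + ennreal (1 / 8)"
    by (simp add: mult_left_mono add_right_mono)
  also have "\<dots> \<le> ennreal 1"
    by (simp flip: ennreal_numeral ennreal_mult ennreal_plus del: ennreal_1)
  finally show ?thesis by simp
qed

lemma double_average_bounded: "bounded_on_Lp corner_exponent double_average"
proof (rule bounded_on_Lp_of_modular)
  have borel_version: "\<exists>g\<in>borel_measurable borel. AE z in lborel. z \<in> square \<longrightarrow> f z = g z"
    if "f \<in> borel_measurable (lebesgue_on square)" for f :: "real \<times> real \<Rightarrow> real"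
  proof -
    have "(\<lambda>z. indicator square z *\<^sub>R f z) \<in> borel_measurable lebesgue"
      using that by (subst (asm) borel_measurable_restrict_space_iff) auto
    then obtain g where g: "g \<in> borel_measurable lborel"
      and eq: "AE z in lborel. indicator square z *\<^sub>R f z = g z"
      using completion_ex_borel_measurable_real by blast
    have "AE z in lborel. z \<in> square \<longrightarrow> f z = g z"
      using eq by (rule eventually_mono) auto
    then show ?thesis
      using g by auto
  qed
  fix f :: "real \<times> real \<Rightarrow> real"
  assume "f \<in> borel_measurable (lebesgue_on square)"
  then obtain g where g: "g \<in> borel_measurable borel" and eq: "AE z in lborel. z \<in> square \<longrightarrow> f z = g z"
    using borel_version by blast
  note avg = double_average_eq_lborel[OF g eq]
  have "lborel_double_average g \<in> borel_measurable (lebesgue_on square)"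
    using lborel_double_average_measurable[OF g]
    by (intro measurable_restrict_space1 measurable_completion) simp
  then show "double_average f \<in> borel_measurable (lebesgue_on square)"
    by (subst measurable_cong[where g = "lborel_double_average g"]) (auto simp: avg)
  show "modular corner_exponent (\<lambda>z. double_average f z / 10) \<le> 1" if "modular corner_exponent f \<le> 1"
  proof -
    have "modular corner_exponent (\<lambda>z. double_average f z / 10) =
        (\<integral>\<^sup>+ z\<in>square. ennreal (\<bar>lborel_double_average g z / 10\<bar> powr corner_exponent z) \<partial>lborel)"
      by (intro modular_eq_lborel) (simp add: avg)
    also have "\<dots> \<le> 1"
      using that by (intro modular_double_average_le g) (simp add: modular_eq_lborel[OF eq])
    finally show ?thesis .
  qed
qed (auto simp: double_average_def fun_eq_iff)

theorem corollary3p5: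
  "\<exists>p. exponent p \<and> \<not> constant_exponent p \<and> bounded_on_Lp p double_average"
  using exponent_corner_exponent not_constant_corner_exponent double_average_bounded by blast

end
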